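(* Let $G$ be a simple, simply-laced, simply-connected algebraic group, $P=P_I=P^\alpha$ a minuscule parabolic subgroup, and $w\in W^I$, $w\neq1$. Let $\widehat w=(w_1,\ldots,w_m)$ be a generalized reduced decomposition of $w$ obtained by Construction 1, and let $(s_{\beta_1},\ldots,s_{\beta_r})$ be a reduced decomposition of $w$ refining it. Assume that $w\neq w_1$. Then $$w_1^{-1}(\beta_1)>w^{-1}(\beta_1).$$
   Context: $R$ is the root system of $G$ with respect to a maximal torus $T$ contained in a Borel subgroup $B$, $R^+$ the positive roots (roots of $B$), $S$ the simple roots, $W$ the Weyl group with length $\ell$. $P^\alpha=P_I\supset B$, $I=S\setminus\{\alpha\}$, is the maximal parabolic subgroup associated with $\alpha\in S$; it is minuscule if the fundamental weight $\varpi_\alpha$ satisfies $\langle\varpi_\alpha,\beta^\vee\rangle\le1$ for all $\beta\in R^+$. $W^I=\{w\in W:w(\beta)\in R^+\ \forall\beta\in I\}$. For weights, $\lambda\ge\mu$ means that $\lambda-\mu$ is a linear combination of simple roots with non-negative integer coefficients, and $\lambda>\mu$ means $\lambda\geq\mu$ and $\lambda\neq\mu$. **Construction 1 (Perrin).** Let $w=s_{\beta_1}\cdots s_{\beta_r}$ be a reduced decomposition ($\beta_i\in S$). The quiver $Q_w$ has vertices $1,\ldots,r$, with an arrow $i\to j$ when $i<j$, $\langle\beta_i,\beta_j^\vee\rangle\ne0$ and $j<s(i)$, where $s(i)$ is the smallest $l>i$ with $\beta_l=\beta_i$ (no condition $j<s(i)$ if there is no such $l$). Up to relabelling, $Q_w$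 depends only on $w$ (any two reduced decompositions of $w$ differ by commutations). Write $k\preceq j$ if $k=j$ or there is an oriented path from $j$ to $k$; peaks are the maximal vertices for $\preceq$, i.e. those with no incoming arrow. Choose a total ordering $i_1,\ldots,i_m$ of the set of peaks. For each vertex $k$ let $t(k)=\max\{t:k\preceq i_t\}$, and let $w_t$ be the product, in increasing order of $k$, of the $s_{\beta_k}$ with $t(k)=t$. Then $w=w_1\cdots w_m$ and $\ell(w)=\sum_t\ell(w_t)$; $(w_1,\ldots,w_m)$ is a generalized reduced decomposition obtained by Construction 1. A reduced decomposition of $w$ refines $(w_1,\ldots,w_m)$ if it is the concatenation of reduced decompositions of $w_1,\ldots,w_m$; thus $\beta_1$ is the simple root of the first letter of a reduced decomposition of $w_1$. *)

theory Defs
  imports "HOL-Analysis.Analysis"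
begin

section \<open>Root systems in a Euclidean space\<close>

text \<open>
  The simple, simply-laced, simply-connected group enters only through its root system, realised
  in the real span of the character group of a maximal torus with a Weyl-invariant inner product.
  The pairing of \<open>x\<close> with the coroot of \<open>a\<close> is then \<open>2 (x \<bullet> a) / (a \<bullet> a)\<close>.
\<close>

definition coroot_pairing :: "'a::euclidean_space \<Rightarrow> 'a \<Rightarrow> real" where
  "coroot_pairing x a = 2 * (x \<bullet> a) / (a \<bullet> a)"

definition root_reflection :: "'a::euclidean_space \<Rightarrow> 'a \<Rightarrow> 'a" where
  "root_reflection a x = x - coroot_pairing x a *\<^sub>R a"

definition root_system :: "'a::euclidean_space set \<Rightarrow> bool" where
  "root_system R \<longleftrightarrow>
     finite R \<and> 0 \<notin> R \<and> span R = UNIV \<and>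
     (\<forall>a\<in>R. root_reflection a ` R = R) \<and>
     (\<forall>a\<in>R. \<forall>b\<in>R. coroot_pairing a b \<in> \<int>) \<and>
     (\<forall>a\<in>R. \<forall>c. c *\<^sub>R a \<in> R \<longrightarrow> c = 1 \<or> c = -1)"

definition irreducible_roots :: "'a::euclidean_space set \<Rightarrow> bool" where
  "irreducible_roots R \<longleftrightarrow>
     R \<noteq> {} \<and>
     \<not> (\<exists>A B. A \<noteq> {} \<and> B \<noteq> {} \<and> A \<union> B = R \<and> A \<inter> B = {} \<and> (\<forall>a\<in>A. \<forall>b\<in>B. a \<bullet> b = 0))"

definition simply_laced :: "'a::euclidean_space set \<Rightarrow> bool" where
  "simply_laced R \<longleftrightarrow> (\<forall>a\<in>R. \<forall>b\<in>R. norm a = norm b)"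

text \<open>
  \<open>weight_le S \<mu> \<nu>\<close> is the order \<open>\<mu> \<le> \<nu>\<close> on weights.
\<close>

definition weight_le :: "'a::euclidean_space set \<Rightarrow> 'a \<Rightarrow> 'a \<Rightarrow> bool" where
  "weight_le S \<mu> \<nu> \<longleftrightarrow> (\<exists>c::'a \<Rightarrow> nat. \<nu> - \<mu> = (\<Sum>a\<in>S. real (c a) *\<^sub>R a))"

definition weight_less :: "'a::euclidean_space set \<Rightarrow> 'a \<Rightarrow> 'a \<Rightarrow> bool" where
  "weight_less S \<mu> \<nu> \<longleftrightarrow> weight_le S \<mu> \<nu> \<and> \<mu> \<noteq> \<nu>"

text \<open>
  The choice of a Borel subgroup containing the torus amounts to the choice of a base \<open>S\<close>;
  the roots of the Borel subgroup are the roots that are non-negative combinations of \<open>S\<close>.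
\<close>

definition root_base :: "'a::euclidean_space set \<Rightarrow> 'a set \<Rightarrow> bool" where
  "root_base R S \<longleftrightarrow>
     S \<subseteq> R \<and> independent S \<and> (\<forall>a\<in>R. weight_le S 0 a \<or> weight_le S a 0)"

definition pos_roots :: "'a::euclidean_space set \<Rightarrow> 'a set \<Rightarrow> 'a set" where
  "pos_roots R S = {a \<in> R. weight_le S 0 a}"

definition fundamental_weight :: "'a::euclidean_space set \<Rightarrow> 'a \<Rightarrow> 'a" where
  "fundamental_weight S \<alpha> =
     (THE x. \<forall>\<beta>\<in>S. coroot_pairing x \<beta> = (if \<beta> = \<alpha> then 1 else 0))"

definition minuscule :: "'a::euclidean_space set \<Rightarrow> 'a set \<Rightarrow> 'a \<Rightarrow> bool" where
  "minuscule R S \<alpha> \<longleftrightarrow>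
     (\<forall>\<beta>\<in>pos_roots R S. coroot_pairing (fundamental_weight S \<alpha>) \<beta> \<le> 1)"


section \<open>The Weyl group\<close>

text \<open>
  Reflections being involutions, closure under composition with reflections already yields the
  group they generate.
\<close>

inductive_set weyl_group :: "'a::euclidean_space set \<Rightarrow> ('a \<Rightarrow> 'a) set" for R where
  weyl_id: "id \<in> weyl_group R"
| weyl_reflection: "a \<in> R \<Longrightarrow> w \<in> weyl_group R \<Longrightarrow> root_reflection a \<circ> w \<in> weyl_group R"

definition min_coset_reps ::
    "'a::euclidean_space set \<Rightarrow> 'a set \<Rightarrow> 'a set \<Rightarrow> ('a \<Rightarrow> 'a) set" where
  "min_coset_reps R S I = {w \<in> weyl_group R. \<forall>\<beta>\<in>I. w \<beta> \<in> pos_roots R S}"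

text \<open>A word of simple reflections is encoded by the list of the corresponding simple roots.\<close>

definition word_prod :: "'a::euclidean_space list \<Rightarrow> 'a \<Rightarrow> 'a" where
  "word_prod bs = foldr (\<lambda>b f. root_reflection b \<circ> f) bs id"

definition weyl_length :: "'a::euclidean_space set \<Rightarrow> ('a \<Rightarrow> 'a) \<Rightarrow> nat" where
  "weyl_length S w = (LEAST n. \<exists>bs. set bs \<subseteq> S \<and> word_prod bs = w \<and> length bs = n)"

definition reduced_decomposition ::
    "'a::euclidean_space set \<Rightarrow> ('a \<Rightarrow> 'a) \<Rightarrow> 'a list \<Rightarrow> bool" where
  "reduced_decomposition S w bs \<longleftrightarrow>
     set bs \<subseteq> S \<and> word_prod bs = w \<and> length bs = weyl_length S w"


section \<open>The quiver of a reduced decomposition and Perrin's construction\<close>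

text \<open>
  The vertices are the positions \<open>0, \<dots>, r - 1\<close> of the list, and peaks and factors are likewise
  numbered from \<open>0\<close>.
\<close>

definition later_occurrence :: "'a list \<Rightarrow> nat \<Rightarrow> nat \<Rightarrow> bool" where
  "later_occurrence bs i l \<longleftrightarrow> i < l \<and> l < length bs \<and> bs ! l = bs ! i"

definition quiver_arrow :: "'a::euclidean_space list \<Rightarrow> nat \<Rightarrow> nat \<Rightarrow> bool" where
  "quiver_arrow bs i j \<longleftrightarrow>
     i < j \<and> j < length bs \<and> coroot_pairing (bs ! i) (bs ! j) \<noteq> 0 \<and>
     ((\<exists>l. later_occurrence bs i l) \<longrightarrow> j < (LEAST l. later_occurrence bs i l))"

text \<open>\<open>quiver_le bs k j\<close> means \<open>k \<preceq> j\<close>: paths run downwards, from \<open>j\<close> to \<open>k\<close>.\<close>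

definition quiver_le :: "'a::euclidean_space list \<Rightarrow> nat \<Rightarrow> nat \<Rightarrow> bool" where
  "quiver_le bs k j \<longleftrightarrow> (quiver_arrow bs)\<^sup>*\<^sup>* j k"

definition peaks :: "'a::euclidean_space list \<Rightarrow> nat set" where
  "peaks bs = {k. k < length bs \<and> (\<forall>j<length bs. quiver_le bs k j \<longrightarrow> j = k)}"

definition last_peak_above :: "'a::euclidean_space list \<Rightarrow> nat list \<Rightarrow> nat \<Rightarrow> nat" where
  "last_peak_above bs ps k = Max {t. t < length ps \<and> quiver_le bs k (ps ! t)}"

definition peak_factor :: "'a::euclidean_space list \<Rightarrow> nat list \<Rightarrow> nat \<Rightarrow> 'a \<Rightarrow> 'a" where
  "peak_factor bs ps t =
     word_prod (map (\<lambda>k. bs ! k) (filter (\<lambda>k. last_peak_above bs ps k = t) [0..<length bs]))"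

text \<open>
  The list \<open>ps\<close> is the chosen total ordering of the peaks. The reduced decomposition \<open>bs\<close> used to
  build the quiver is existentially quantified, since the quiver depends on it only up to
  relabelling.
\<close>

definition perrin_decomposition ::
    "'a::euclidean_space set \<Rightarrow> ('a \<Rightarrow> 'a) \<Rightarrow> ('a \<Rightarrow> 'a) list \<Rightarrow> bool" where
  "perrin_decomposition S w ws \<longleftrightarrow>
     (\<exists>bs ps. reduced_decomposition S w bs \<and> distinct ps \<and> set ps = peaks bs \<and>
              ws = map (peak_factor bs ps) [0..<length ps])"

definition refining_decomposition ::
    "'a::euclidean_space set \<Rightarrow> 'a list \<Rightarrow> ('a \<Rightarrow> 'a) list \<Rightarrow> bool" where
  "refining_decomposition S bs ws \<longleftrightarrow>
     (\<exists>bss. list_all2 (reduced_decomposition S) ws bss \<and> bs = concat bss)"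

end

theory Submission imports Defs begin

text \<open>
  Let \<open>\<varpi>\<close> be the fundamental weight of \<open>\<alpha>\<close>. Since \<open>w\<close> is a minimal coset representative and
  \<open>\<varpi>\<close> is minuscule, each letter of a reduced word of \<open>w\<close>, read from the right, has pairing
  exactly \<open>1\<close> with the weight it is applied to. Write \<open>w = w\<^sub>1 v\<close> and \<open>\<gamma> = - w\<^sub>1\<^sup>-\<^sup>1(\<beta>\<^sub>1)\<close>, so that
  \<open>\<gamma>\<close> has pairing \<open>1\<close> with \<open>v \<varpi>\<close> and the claim reads \<open>v\<^sup>-\<^sup>1 \<gamma> > \<gamma>\<close>. Because no weight in the orbit
  of \<open>\<varpi>\<close> has pairing greater than \<open>1\<close> with a root, applying the letters of \<open>v\<close> in turn to \<open>\<gamma>\<close>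
  can only add simple roots.

  If \<open>v\<^sup>-\<^sup>1 \<gamma> = \<gamma>\<close>, then \<open>\<gamma>\<close> is orthogonal to every letter of \<open>v\<close>, and its coefficient at \<open>\<alpha>\<close> is its
  pairing with \<open>\<varpi>\<close>, which is \<open>1\<close>; in particular \<open>\<gamma>\<close> is positive. The letter of a peak other than
  the first one does not occur in \<open>w\<^sub>1\<close>, so \<open>\<gamma>\<close> has coefficient \<open>0\<close> there. Orthogonality propagates
  the vanishing of coefficients along the arrows of the quiver down to its unique sink, whose letter
  is \<open>\<alpha>\<close>, a contradiction.
\<close>

section \<open>Reflections and words of reflections\<close>

lemma coroot_pairing_diff_left: "coroot_pairing (x - y) a = coroot_pairing x a - coroot_pairing y a"
  by (simp add: coroot_pairing_def inner_diff_left diff_divide_distrib right_diff_distrib)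

lemma coroot_pairing_minus_right: "coroot_pairing x (- a) = - coroot_pairing x a"
  by (simp add: coroot_pairing_def)

lemma coroot_pairing_self: "a \<noteq> 0 \<Longrightarrow> coroot_pairing a a = 2"
  by (simp add: coroot_pairing_def)

lemma coroot_pairing_eq_0_iff: "coroot_pairing x a = 0 \<longleftrightarrow> x \<bullet> a = 0"
  by (auto simp: coroot_pairing_def)

lemma root_reflection_0 [simp]: "root_reflection 0 x = x"
  by (simp add: root_reflection_def)

lemma linear_root_reflection: "linear (root_reflection a)"
  by (rule linearI)
    (simp_all add: root_reflection_def coroot_pairing_def inner_add_left algebra_simps add_divide_distrib)

lemma inner_root_reflection: "root_reflection a x \<bullet> root_reflection a y = x \<bullet> y"
proof (cases "a = 0")
  case False
  then show ?thesis
    by (simp add: root_reflection_def coroot_pairing_def inner_diff_left inner_diff_right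
        inner_commute[of a x] inner_commute[of a y])
qed simp

lemma root_reflection_self: "a \<noteq> 0 \<Longrightarrow> root_reflection a a = - a"
  by (simp add: root_reflection_def coroot_pairing_self scaleR_2)

lemma coroot_pairing_root_reflection_self:
  "coroot_pairing (root_reflection b x) b = - coroot_pairing x b"
  by (cases "b = 0") (simp_all add: root_reflection_def coroot_pairing_def inner_diff_left field_simps)

lemma root_reflection_involution [simp]: "root_reflection a (root_reflection a x) = x"
  using coroot_pairing_root_reflection_self[of a x]
  by (simp add: root_reflection_def[of a "root_reflection a x"]) (simp add: root_reflection_def)

lemma root_reflection_commute:
  assumes "a \<bullet> b = 0"
  shows "root_reflection a (root_reflection b x) = root_reflection b (root_reflection a x)"
  using assms
  by (simp add: root_reflection_def coroot_pairing_def inner_diff_left inner_commute algebra_simps)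

lemma word_prod_Nil [simp]: "word_prod [] = id"
  by (simp add: word_prod_def)

lemma word_prod_Cons [simp]: "word_prod (b # bs) = root_reflection b \<circ> word_prod bs"
  by (simp add: word_prod_def)

lemma word_prod_append [simp]: "word_prod (bs @ cs) = word_prod bs \<circ> word_prod cs"
  by (induction bs) auto

lemma linear_word_prod: "linear (word_prod bs)"
proof (induction bs)
  case (Cons b bs)
  then show ?case using linear_compose[OF _ linear_root_reflection] by (metis word_prod_Cons)
qed (simp add: id_def linear_ident)

lemma inner_word_prod: "word_prod bs x \<bullet> word_prod bs y = x \<bullet> y"
  by (induction bs) (auto simp: inner_root_reflection)

lemma word_prod_rev [simp]: "word_prod bs (word_prod (rev bs) x) = x"
  by (induction bs arbitrary: x) auto

lemma word_prod_rev' [simp]: "word_prod (rev bs) (word_prod bs x) = x"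
  using word_prod_rev[of "rev bs"] by simp

lemma inv_word_prod: "inv (word_prod bs) = word_prod (rev bs)"
  by (rule inv_equality) auto

lemma coroot_pairing_word_prod:
  "coroot_pairing (word_prod bs x) (word_prod bs y) = coroot_pairing x y"
  by (simp add: coroot_pairing_def inner_word_prod)

lemma coroot_pairing_word_prod_left:
  "coroot_pairing (word_prod bs x) y = coroot_pairing x (word_prod (rev bs) y)"
  by (metis coroot_pairing_word_prod word_prod_rev)

lemma root_reflection_word_prod:
  "root_reflection (word_prod bs a) (word_prod bs x) = word_prod bs (root_reflection a x)"
  by (simp add: root_reflection_def coroot_pairing_word_prod linear_diff[OF linear_word_prod]
      linear_scale[OF linear_word_prod])

lemma root_reflection_word_prod_commute:
  assumes "\<forall>b\<in>set bs. a \<bullet> b = 0"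
  shows "root_reflection a (word_prod bs x) = word_prod bs (root_reflection a x)"
  using assms by (induction bs) (auto simp: root_reflection_commute)

text \<open>Orthogonal reflections commute, so the letters in \<open>U\<close> can move left past
  the others; the hypothesis covers exactly the pairs that change order. This serves to split off
  the first factor.\<close>

lemma word_prod_filter:
  assumes "sorted_wrt (\<lambda>i j. \<not> U i \<longrightarrow> U j \<longrightarrow> f i \<bullet> f j = 0) ks"
  shows "word_prod (map f ks) =
    word_prod (map f (filter U ks)) \<circ> word_prod (map f (filter (\<lambda>k. \<not> U k) ks))"
  using assms
proof (induction ks)
  case (Cons k ks)
  then show ?case
    using root_reflection_word_prod_commute[of "map f (filter U ks)" "f k"]
    by (auto simp: fun_eq_iff)
qed simp

text \<open>Each letter, read from the right, subtracts exactly itself from the weight it acts on.\<close>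

fun lowering_word :: "'a::euclidean_space \<Rightarrow> 'a list \<Rightarrow> bool" where
  "lowering_word x [] \<longleftrightarrow> True"
| "lowering_word x (b # bs) \<longleftrightarrow> coroot_pairing (word_prod bs x) b = 1 \<and> lowering_word x bs"

lemma lowering_word_append: "lowering_word x (bs @ cs) \<Longrightarrow> lowering_word x cs"
  by (induction bs) auto

lemma lowering_word_nth:
  "lowering_word x bs \<Longrightarrow> k < length bs \<Longrightarrow>
    coroot_pairing (word_prod (drop (Suc k) bs) x) (bs ! k) = 1"
  by (induction bs arbitrary: k) (auto simp: nth_Cons split: nat.split)

text \<open>Reflecting the weight in a letter orthogonal to \<open>b\<close> does not affect its
  pairing with \<open>b\<close>.\<close>

lemma coroot_pairing_drop_orthogonal:
  assumes "i \<le> j" "j \<le> length bs" "\<And>q. i \<le> q \<Longrightarrow> q < j \<Longrightarrow> b \<bullet> (bs ! q) = 0"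
  shows "coroot_pairing (word_prod (drop i bs) x) b = coroot_pairing (word_prod (drop j bs) x) b"
  using assms
proof (induction rule: inc_induct)
  case (step i)
  then have "coroot_pairing (word_prod (drop i bs) x) b
      = coroot_pairing (root_reflection (bs ! i) (word_prod (drop (Suc i) bs) x)) b"
    by (simp flip: Cons_nth_drop_Suc)
  also have "\<dots> = coroot_pairing (word_prod (drop (Suc i) bs) x) b"
  proof -
    have "(bs ! i) \<bullet> b = 0" using step.prems(2)[of i] step.hyps by (simp add: inner_commute)
    then show ?thesis
      by (simp add: root_reflection_def coroot_pairing_def inner_diff_left)
  qed
  finally show ?case using step by simp
qed simp

section \<open>The quiver order and its peaks\<close>

lemma quiver_arrow_less: "quiver_arrow bs i j \<Longrightarrow> i < j \<and> j < length bs"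
  by (simp add: quiver_arrow_def)

lemma quiver_le_imp_le: "quiver_le bs k j \<Longrightarrow> j \<le> k"
  unfolding quiver_le_def
  by (induction rule: rtranclp_induct) (auto dest: quiver_arrow_less)

lemma quiver_le_refl: "quiver_le bs k k"
  by (simp add: quiver_le_def)

lemma quiver_le_trans: "quiver_le bs k j \<Longrightarrow> quiver_le bs j i \<Longrightarrow> quiver_le bs k i"
  unfolding quiver_le_def by (rule rtranclp_trans)

text \<open>
  Two equal letters cannot be separated by letters orthogonal to them: the pairing of the weight
  with that letter is \<open>-1\<close> after the later occurrence and has to be \<open>1\<close> before the earlier one.
\<close>

lemma lowering_word_between:
  assumes low: "lowering_word x bs" and "i < j" "j < length bs" "bs ! i = bs ! j"
  shows "\<exists>q. i < q \<and> q < j \<and> (bs ! j) \<bullet> (bs ! q) \<noteq> 0"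
proof (rule ccontr)
  assume *: "\<not> ?thesis"
  have "coroot_pairing (word_prod (drop (Suc i) bs) x) (bs ! j)
      = coroot_pairing (word_prod (drop j bs) x) (bs ! j)"
    by (rule coroot_pairing_drop_orthogonal) (use * assms in \<open>auto simp: Suc_le_eq\<close>)
  also have "\<dots> = - coroot_pairing (word_prod (drop (Suc j) bs) x) (bs ! j)"
    using assms by (simp add: coroot_pairing_root_reflection_self flip: Cons_nth_drop_Suc)
  finally show False
    using lowering_word_nth[OF low, of i] lowering_word_nth[OF low, of j] assms by simp
qed

text \<open>Induction on the gap: a repetition of \<open>bs ! i\<close> in between, or, for equal
  end letters, the letter supplied by \<open>lowering_word_between\<close>, cuts the gap into two
  shorter ones; otherwise there is an arrow.\<close>

lemma quiver_le_of_nonorthogonal: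
  assumes low: "lowering_word x bs" and "0 \<notin> set bs"
  shows "i < j \<Longrightarrow> j < length bs \<Longrightarrow> (bs ! i) \<bullet> (bs ! j) \<noteq> 0 \<Longrightarrow> quiver_le bs j i"
proof (induction "j - i" arbitrary: i j rule: less_induct)
  case less
  show ?case
  proof (cases "\<exists>q. i < q \<and> q < j \<and> bs ! q = bs ! i")
    case True
    then obtain q where q: "i < q" "q < j" "bs ! q = bs ! i" by blast
    have nz: "bs ! i \<noteq> 0" using assms(2) less.prems by (metis less_trans nth_mem)
    have "quiver_le bs q i" "quiver_le bs j q"
      by (rule less.hyps; use q less.prems nz in auto)+
    then show ?thesis by (blast intro: quiver_le_trans)
  next
    case False
    show ?thesis
    proof (cases "bs ! i = bs ! j")
      case True
      then obtain q where q: "i < q" "q < j" "(bs ! j) \<bullet> (bs ! q) \<noteq> 0"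
        using lowering_word_between[OF low] less.prems by blast
      have "quiver_le bs q i" "quiver_le bs j q"
        by (rule less.hyps; use q less.prems True in \<open>auto simp: inner_commute\<close>)+
      then show ?thesis by (blast intro: quiver_le_trans)
    next
      case neq: False
      \<comment> \<open>With no repetition strictly between and distinct end letters, the next
        occurrence of \<open>bs ! i\<close> lies beyond \<open>j\<close>.\<close>
      have "j < (LEAST l. later_occurrence bs i l)" if "\<exists>l. later_occurrence bs i l"
        using LeastI_ex[OF that] False neq
        unfolding later_occurrence_def by (metis linorder_neqE_nat)
      then have "quiver_arrow bs i j"
        using less.prems by (auto simp: quiver_arrow_def coroot_pairing_eq_0_iff)
      then show ?thesis by (simp add: quiver_le_def)
    qed
  qed
qed

text \<open>A vertex that is not a peak lies below another one, and going up strictly decreases the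
  position.\<close>

lemma exists_peak_above:
  "k < length bs \<Longrightarrow> \<exists>p\<in>peaks bs. quiver_le bs k p"
proof (induction k rule: less_induct)
  case (less k)
  show ?case
  proof (cases "k \<in> peaks bs")
    case True
    then show ?thesis using quiver_le_refl by blast
  next
    case False
    then obtain j where j: "j < length bs" "quiver_le bs k j" "j \<noteq> k"
      using less.prems by (auto simp: peaks_def)
    with quiver_le_imp_le[of bs k j] less.IH[of j] show ?thesis
      by (meson le_neq_implies_less quiver_le_trans)
  qed
qed

text \<open>Every vertex lies below some peak, so the \<open>Max\<close> is taken over a nonempty
  finite set and is attained.\<close>

lemma last_peak_above_eq_0_iff:
  assumes "set ps = peaks bs" "k < length bs"
  shows "last_peak_above bs ps k = 0 \<longleftrightarrow> (\<forall>t<length ps. quiver_le bs k (ps ! t) \<longrightarrow> t = 0)"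
proof -
  let ?A = "{t. t < length ps \<and> quiver_le bs k (ps ! t)}"
  have "?A \<noteq> {}"
    using exists_peak_above[OF assms(2)] assms(1) by (metis (mono_tags, lifting) empty_iff in_set_conv_nth mem_Collect_eq)
  moreover have "finite ?A" by simp
  ultimately have "Max ?A = 0 \<longleftrightarrow> (\<forall>t\<in>?A. t = 0)"
    by (metis (no_types, lifting) Max_ge Max_in le_zero_eq)
  then show ?thesis by (auto simp: last_peak_above_def)
qed

section \<open>The order on weights\<close>

lemma weight_le_refl: "weight_le S x x"
  unfolding weight_le_def by (rule exI[of _ "\<lambda>_. 0"]) simp

lemma weight_le_trans:
  assumes "weight_le S x y" "weight_le S y z" shows "weight_le S x z"
proof -
  from assms obtain c d :: "'a \<Rightarrow> nat" where
    "y - x = (\<Sum>a\<in>S. real (c a) *\<^sub>R a)" "z - y = (\<Sum>a\<in>S. real (d a) *\<^sub>R a)"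
    unfolding weight_le_def by auto
  then have "(y - x) + (z - y) = (\<Sum>a\<in>S. real (c a + d a) *\<^sub>R a)"
    by (simp only: of_nat_add scaleR_add_left sum.distrib)
  then have "z - x = (\<Sum>a\<in>S. real (c a + d a) *\<^sub>R a)" by simp
  then show ?thesis unfolding weight_le_def by (intro exI[of _ "\<lambda>a. c a + d a"])
qed

lemma weight_le_add_multiple:
  assumes "finite S" "b \<in> S" shows "weight_le S x (x + real n *\<^sub>R b)"
  unfolding weight_le_def
proof (rule exI)
  show "x + real n *\<^sub>R b - x = (\<Sum>a\<in>S. real (if a = b then n else 0) *\<^sub>R a)"
    using assms by (simp add: if_distrib[where f = "\<lambda>k. real k *\<^sub>R _"] cong: if_cong)
qed

section \<open>Coordinates and signs of roots\<close>

locale simply_laced_base =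
  fixes R S :: "'a::euclidean_space set"
  assumes root_system: "root_system R" and simply_laced: "simply_laced R" and base: "root_base R S"
begin

lemma base_subset: "S \<subseteq> R"
  using base by (simp add: root_base_def)

lemma finite_base: "finite S"
  using base_subset root_system finite_subset by (auto simp: root_system_def)

lemma independent_base: "independent S"
  using base by (simp add: root_base_def)

lemma root_nonzero: "a \<in> R \<Longrightarrow> a \<noteq> 0"
  using root_system by (auto simp: root_system_def)

lemma reflection_in_roots: "a \<in> R \<Longrightarrow> b \<in> R \<Longrightarrow> root_reflection a b \<in> R"
  using root_system by (auto simp: root_system_def)

lemma uminus_in_roots: "a \<in> R \<Longrightarrow> - a \<in> R"
  using reflection_in_roots[of a a] root_reflection_self root_nonzero by force

lemma word_prod_in_roots: "set bs \<subseteq> S \<Longrightarrow> a \<in> R \<Longrightarrow> word_prod bs a \<in> R"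
  using base_subset by (induction bs) (auto intro: reflection_in_roots)

lemma base_spans: "span S = UNIV"
proof -
  have "a \<in> span S" if "a \<in> R" for a
  proof -
    have "weight_le S 0 a \<or> weight_le S a 0"
      using base that by (simp add: root_base_def)
    then obtain c :: "'a \<Rightarrow> nat" where "a = (\<Sum>b\<in>S. real (c b) *\<^sub>R b) \<or> - a = (\<Sum>b\<in>S. real (c b) *\<^sub>R b)"
      unfolding weight_le_def by auto
    moreover have "(\<Sum>b\<in>S. real (c b) *\<^sub>R b) \<in> span S"
      by (intro span_sum span_scale span_base)
    ultimately show ?thesis by (metis span_neg minus_minus)
  qed
  then have "span R \<subseteq> span S" by (simp add: span_minimal subsetI)
  then show ?thesis using root_system by (auto simp: root_system_def)
qed

definition coeff :: "'a \<Rightarrow> 'a \<Rightarrow> real" where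
  "coeff x b = representation S x b"

lemma coeff_add: "coeff (x + y) b = coeff x b + coeff y b"
  by (simp add: coeff_def representation_add independent_base base_spans)

lemma coeff_scale: "coeff (r *\<^sub>R x) b = r * coeff x b"
  by (simp add: coeff_def representation_scale independent_base base_spans)

lemma coeff_minus: "coeff (- x) b = - coeff x b"
  using coeff_scale[of "-1"] by simp

lemma coeff_diff: "coeff (x - y) b = coeff x b - coeff y b"
  using coeff_add[of x "- y"] by (simp add: coeff_minus)

lemma coeff_sum: "coeff (sum f A) b = (\<Sum>a\<in>A. coeff (f a) b)"
  by (simp add: coeff_def representation_sum independent_base base_spans)

lemma coeff_base: "a \<in> S \<Longrightarrow> coeff a b = (if b = a then 1 else 0)"
  by (simp add: coeff_def representation_basis independent_base)

lemma sum_coeff: "(\<Sum>b\<in>S. coeff x b *\<^sub>R b) = x"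
  by (simp add: coeff_def sum_representation_eq independent_base base_spans finite_base)

lemma weight_le_coeff: "weight_le S x y \<Longrightarrow> coeff x b \<le> coeff y b"
proof -
  assume "weight_le S x y"
  then obtain c :: "'a \<Rightarrow> nat" where "y - x = (\<Sum>a\<in>S. real (c a) *\<^sub>R a)"
    unfolding weight_le_def by auto
  then have "coeff y b - coeff x b = (\<Sum>a\<in>S. real (c a) * coeff a b)"
    by (metis (no_types, lifting) coeff_diff coeff_sum coeff_scale sum.cong)
  also have "\<dots> \<ge> 0" by (auto intro!: sum_nonneg simp: coeff_base)
  finally show ?thesis by simp
qed

lemma weight_le_antisym: "weight_le S x y \<Longrightarrow> weight_le S y x \<Longrightarrow> x = y"
  using weight_le_coeff[of x y] weight_le_coeff[of y x] sum_coeff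
  by (metis (no_types, lifting) order_antisym sum.cong)

lemma root_cases: "a \<in> R \<Longrightarrow> a \<in> pos_roots R S \<or> - a \<in> pos_roots R S"
  using base by (auto simp: root_base_def pos_roots_def weight_le_def uminus_in_roots)

lemma pos_root_coeff: "a \<in> pos_roots R S \<Longrightarrow> 0 \<le> coeff a b"
  using weight_le_coeff[of 0 a b] coeff_scale[of 0 0] by (simp add: pos_roots_def)

lemma pos_root_of_coeff:
  assumes "a \<in> R" "coeff a b > 0" shows "a \<in> pos_roots R S"
  using root_cases[OF assms(1)] pos_root_coeff[of "- a" b] assms(2) by (auto simp: coeff_minus)

lemma base_subset_pos_roots: "S \<subseteq> pos_roots R S"
  using pos_root_of_coeff base_subset by (force simp: coeff_base)

text \<open>A positive product would give the reflection of \<open>a\<close> in \<open>b\<close>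
  coefficient 1 at \<open>a\<close> and a negative one at \<open>b\<close>, which no root
  has.\<close>

lemma base_inner_nonpos:
  assumes "a \<in> S" "b \<in> S" "a \<noteq> b" shows "a \<bullet> b \<le> 0"
proof (rule ccontr)
  assume "\<not> ?thesis"
  moreover have "b \<noteq> 0" using assms base_subset root_nonzero by auto
  ultimately have n: "coroot_pairing a b > 0" by (simp add: coroot_pairing_def)
  let ?r = "root_reflection b a"
  have "?r \<in> R" using assms base_subset reflection_in_roots by auto
  moreover have "coeff ?r a = 1" "coeff ?r b < 0"
    using assms n by (auto simp: root_reflection_def coeff_diff coeff_scale coeff_base)
  ultimately show False using pos_root_of_coeff[of ?r a] pos_root_coeff[of ?r b] by simp
qed

text \<open>The reflection changes only the coefficient at \<open>b\<close>, and one positive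
  coefficient elsewhere already makes a root positive.\<close>

lemma reflection_pos_root:
  assumes "a \<in> pos_roots R S" "b \<in> S" "a \<noteq> b"
  shows "root_reflection b a \<in> pos_roots R S"
proof -
  have aR: "a \<in> R" using assms by (simp add: pos_roots_def)
  have "\<exists>c\<in>S. c \<noteq> b \<and> coeff a c > 0"
  proof (rule ccontr)
    assume "\<not> ?thesis"
    then have "coeff a c = 0" if "c \<in> S" "c \<noteq> b" for c
      using that pos_root_coeff[OF assms(1), of c] by fastforce
    then have "(\<Sum>c\<in>S. coeff a c *\<^sub>R c) = (\<Sum>c\<in>S. if c = b then coeff a b *\<^sub>R b else 0)"
      by (intro sum.cong) auto
    \<comment> \<open>The only multiples of \<open>b\<close> in \<open>R\<close> are
      \<open>b\<close> and \<open>- b\<close>; the first is excluded by hypothesis, the second by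
      positivity of \<open>a\<close>.\<close>
    then have a: "a = coeff a b *\<^sub>R b" using finite_base assms by (simp add: sum_coeff)
    moreover have "b \<in> R" using assms base_subset by auto
    ultimately have "coeff a b = 1 \<or> coeff a b = -1"
      using root_system aR unfolding root_system_def by metis
    with a assms pos_root_coeff[OF assms(1), of b] show False by auto
  qed
  then obtain c where c: "c \<in> S" "c \<noteq> b" "coeff a c > 0" by blast
  then have "coeff (root_reflection b a) c > 0"
    using assms by (simp add: root_reflection_def coeff_diff coeff_scale coeff_base)
  moreover have "root_reflection b a \<in> R"
    using aR assms base_subset reflection_in_roots by auto
  ultimately show ?thesis using pos_root_of_coeff by blast
qed

section \<open>Reduced words\<close>

text \<open>Carried through \<open>cs\<close> from the right, the root \<open>b\<close> stops being
  positive at some letter. Just before, it equals the root of that letter, so this letter and the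
  final \<open>b\<close> cancel: at least two letters are lost.\<close>

lemma exchange:
  assumes "set cs \<subseteq> S" "b \<in> S" "word_prod cs b \<notin> pos_roots R S"
  shows "\<exists>ds. set ds \<subseteq> S \<and> length ds < length cs \<and> word_prod (cs @ [b]) = word_prod ds"
  using assms
proof (induction cs)
  case Nil
  then show ?case using base_subset_pos_roots by auto
next
  case (Cons c cs)
  show ?case
  proof (cases "word_prod cs b \<in> pos_roots R S")
    case True
    then have "word_prod cs b = c"
      using reflection_pos_root[of "word_prod cs b" c] Cons.prems by auto
    then have "word_prod ((c # cs) @ [b]) = word_prod cs"
      using root_reflection_word_prod[of cs b] by (auto simp: fun_eq_iff)
    then show ?thesis using Cons.prems by (intro exI[of _ cs]) auto
  next
    case False
    then obtain ds where ds: "set ds \<subseteq> S" "length ds < length cs" "word_prod (cs @ [b]) = word_prod ds"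
      using Cons by (metis insert_subset list.simps(15))
    then have "word_prod ((c # cs) @ [b]) = word_prod (c # ds)" by (simp add: comp_assoc)
    then show ?thesis using ds Cons.prems by (intro exI[of _ "c # ds"]) auto
  qed
qed

lemma reduced_minimal:
  assumes "reduced_decomposition S w bs" "set cs \<subseteq> S" "word_prod cs = w"
  shows "length bs \<le> length cs"
  using assms Least_le[of "\<lambda>n. \<exists>bs. set bs \<subseteq> S \<and> word_prod bs = w \<and> length bs = n" "length cs"]
  by (auto simp: reduced_decomposition_def weyl_length_def)

lemma reduced_prefix_pos:
  assumes "reduced_decomposition S w (cs @ b # ds)"
  shows "word_prod cs b \<in> pos_roots R S"
proof (rule ccontr)
  assume "\<not> ?thesis"
  with exchange[of cs b] obtain es where es: "set es \<subseteq> S" "length es < length cs"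
    "word_prod (cs @ [b]) = word_prod es"
    using assms by (auto simp: reduced_decomposition_def)
  then have "word_prod (es @ ds) = word_prod ((cs @ [b]) @ ds)" by (simp only: word_prod_append)
  then have "word_prod (es @ ds) = w" using assms by (simp add: reduced_decomposition_def)
  then have "length (cs @ b # ds) \<le> length (es @ ds)"
    using reduced_minimal[OF assms, of "es @ ds"] es assms by (auto simp: reduced_decomposition_def)
  then show False using es by simp
qed

text \<open>Mirror image of \<open>reduced_prefix_pos\<close>: reversal inverts the product, so
  \<open>exchange\<close> applies to the reversed suffix.\<close>

lemma reduced_suffix_pos:
  assumes "reduced_decomposition S w (cs @ b # ds)"
  shows "word_prod (rev ds) b \<in> pos_roots R S"
proof (rule ccontr)
  assume "\<not> ?thesis"
  with exchange[of "rev ds" b] obtain es where es: "set es \<subseteq> S" "length es < length ds"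
    "word_prod (rev (b # ds)) = word_prod es"
    using assms by (auto simp: reduced_decomposition_def)
  then have "word_prod (rev es) = word_prod (b # ds)"
    by (metis inv_word_prod rev_rev_ident)
  then have "word_prod (cs @ rev es) = w" using assms by (simp add: reduced_decomposition_def)
  then have "length (cs @ b # ds) \<le> length (cs @ rev es)"
    using reduced_minimal[OF assms, of "cs @ rev es"] es assms
    by (auto simp: reduced_decomposition_def)
  then show False using es by simp
qed

section \<open>The fundamental weight and minusculity\<close>

lemma root_inner_self_eq: "a \<in> R \<Longrightarrow> b \<in> R \<Longrightarrow> a \<bullet> a = b \<bullet> b"
  using simply_laced unfolding simply_laced_def dot_square_norm by metis

lemma root_pairing_commute: "a \<in> R \<Longrightarrow> b \<in> R \<Longrightarrow> coroot_pairing a b = coroot_pairing b a"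
  using root_inner_self_eq[of a b] by (simp add: coroot_pairing_def inner_commute)

text \<open>Justifies the definite description: existence comes from independence of
  \<open>S\<close>, uniqueness from its spanning the space.\<close>

lemma fundamental_weight_pairing_base:
  assumes "\<alpha> \<in> S" "b \<in> S"
  shows "coroot_pairing (fundamental_weight S \<alpha>) b = (if b = \<alpha> then 1 else 0)"
proof -
  \<comment> \<open>The value \<open>(b \<bullet> b) / 2\<close> cancels the normalisation of the
    coroot; the adjoint then turns \<open>g\<close> into a vector.\<close>
  obtain g :: "'a \<Rightarrow> real" where g: "linear g" "\<And>b. b \<in> S \<Longrightarrow> g b = (if b = \<alpha> then (b \<bullet> b) / 2 else 0)"
    using linear_independent_extend[OF independent_base, of "\<lambda>b. if b = \<alpha> then (b \<bullet> b) / 2 else 0"] by auto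
  define x where "x = adjoint g 1"
  have x: "x \<bullet> y = g y" for y
    using adjoint_works[OF g(1), of y 1] by (simp add: x_def inner_commute)
  have nz: "b \<noteq> 0" if "b \<in> S" for b using that base_subset root_nonzero by auto
  have ex: "\<forall>b\<in>S. coroot_pairing x b = (if b = \<alpha> then 1 else 0)"
    using nz by (simp add: coroot_pairing_def x g(2))
  have uniq: "y = x" if y: "\<forall>b\<in>S. coroot_pairing y b = (if b = \<alpha> then 1 else 0)" for y
  proof -
    have "(y - x) \<bullet> b = 0" if "b \<in> S" for b
    proof -
      have "coroot_pairing (y - x) b = 0" using ex y that by (simp add: coroot_pairing_diff_left)
      then show ?thesis by (simp add: coroot_pairing_eq_0_iff)
    qed
    then have "orthogonal (y - x) (y - x)"
      using orthogonal_to_span[of "y - x" S "y - x"] by (simp add: base_spans orthogonal_def)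
    then show ?thesis by (simp add: orthogonal_def)
  qed
  have "\<forall>b\<in>S. coroot_pairing (fundamental_weight S \<alpha>) b = (if b = \<alpha> then 1 else 0)"
    unfolding fundamental_weight_def
    by (rule theI[where P = "\<lambda>x. \<forall>b\<in>S. coroot_pairing x b = (if b = \<alpha> then 1 else 0)"], rule ex, rule uniq)
  then show ?thesis using assms by blast
qed

text \<open>As all roots have the same length, pairing with a root is linear in that root and is
  determined by the simple roots.\<close>

lemma fundamental_weight_pairing:
  assumes "\<alpha> \<in> S" "a \<in> R"
  shows "coroot_pairing (fundamental_weight S \<alpha>) a = coeff a \<alpha>"
proof -
  let ?x = "fundamental_weight S \<alpha>"
  have *: "2 * (?x \<bullet> b) = (if b = \<alpha> then a \<bullet> a else 0)" if "b \<in> S" for b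
  proof -
    have "b \<in> R" using that base_subset by auto
    then have "a \<bullet> a = b \<bullet> b" "b \<bullet> b \<noteq> 0"
      using root_inner_self_eq[OF assms(2), of b] root_nonzero by auto
    then show ?thesis using fundamental_weight_pairing_base[OF assms(1) that]
      by (auto simp: coroot_pairing_def field_simps split: if_splits)
  qed
  have "2 * (?x \<bullet> a) = (\<Sum>b\<in>S. coeff a b * (2 * (?x \<bullet> b)))"
    by (subst sum_coeff[of a, symmetric]) (simp add: inner_sum_right sum_distrib_left algebra_simps)
  also have "\<dots> = (\<Sum>b\<in>S. if b = \<alpha> then coeff a \<alpha> * (a \<bullet> a) else 0)"
    by (intro sum.cong) (auto simp: *)
  also have "\<dots> = coeff a \<alpha> * (a \<bullet> a)" using assms finite_base by simp
  finally show ?thesis using root_nonzero[OF assms(2)] by (simp add: coroot_pairing_def)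
qed

lemma root_pairing_Ints: "a \<in> R \<Longrightarrow> b \<in> R \<Longrightarrow> coroot_pairing a b \<in> \<int>"
  using root_system by (simp add: root_system_def)

lemma pos_root_coeff_Nats:
  assumes "a \<in> pos_roots R S" "b \<in> S" shows "\<exists>n::nat. coeff a b = real n"
proof -
  obtain c :: "'a \<Rightarrow> nat" where "a = (\<Sum>d\<in>S. real (c d) *\<^sub>R d)"
    using assms unfolding pos_roots_def weight_le_def by auto
  then have "coeff a b = (\<Sum>d\<in>S. real (c d) * coeff d b)"
    by (metis (no_types, lifting) coeff_sum coeff_scale sum.cong)
  also have "\<dots> = (\<Sum>d\<in>S. if d = b then real (c d) else 0)"
    by (intro sum.cong) (auto simp: coeff_base)
  also have "\<dots> = real (c b)" using finite_base assms by simp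
  finally show ?thesis by blast
qed

text \<open>Invariance moves the word onto the root. Minusculity settles a positive root; for a
  negative one the pairing is its non-positive coefficient at \<open>\<alpha>\<close>.\<close>

lemma minuscule_pairing_le_1:
  assumes "\<alpha> \<in> S" "minuscule R S \<alpha>" "set bs \<subseteq> S" "a \<in> R"
  shows "coroot_pairing (word_prod bs (fundamental_weight S \<alpha>)) a \<le> 1"
proof -
  let ?b = "word_prod (rev bs) a"
  have b: "?b \<in> R" using assms by (intro word_prod_in_roots) auto
  have "coroot_pairing (fundamental_weight S \<alpha>) ?b \<le> 1"
  proof (cases "?b \<in> pos_roots R S")
    case True
    then show ?thesis using assms by (simp add: minuscule_def)
  next
    case False
    then have "coeff ?b \<alpha> \<le> 0"
      using root_cases[OF b] pos_root_coeff[of "- ?b" \<alpha>] by (simp add: coeff_minus)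
    then show ?thesis using fundamental_weight_pairing[OF assms(1) b] by simp
  qed
  then show ?thesis by (simp add: coroot_pairing_word_prod_left)
qed

text \<open>The pairing at a letter is the coefficient at \<open>\<alpha>\<close> of the positive
  root \<open>?a\<close>, a natural number at most 1. Were it 0, \<open>?a\<close> would be a
  non-negative combination of simple roots that \<open>w\<close> keeps positive, whereas reducedness
  makes \<open>w ?a\<close> negative. The prefix \<open>cs\<close> keeps the whole word in view
  during the induction.\<close>

lemma reduced_coset_rep_lowering:
  assumes "\<alpha> \<in> S" "minuscule R S \<alpha>" "w \<in> min_coset_reps R S (S - {\<alpha>})"
    and "reduced_decomposition S w (cs @ ds)"
  shows "lowering_word (fundamental_weight S \<alpha>) ds"
  using assms(4)
proof (induction ds arbitrary: cs)
  case (Cons b ds)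
  let ?a = "word_prod (rev ds) b"
  have a: "?a \<in> pos_roots R S" by (rule reduced_suffix_pos[OF Cons.prems])
  have pos: "word_prod cs b \<in> pos_roots R S" by (rule reduced_prefix_pos[OF Cons.prems])
  have sub: "set cs \<subseteq> S" "b \<in> S" "set ds \<subseteq> S" and w: "w = word_prod (cs @ b # ds)"
    using Cons.prems by (auto simp: reduced_decomposition_def)
  have bR: "b \<in> R" using sub base_subset by auto
  have pair: "coroot_pairing (word_prod ds (fundamental_weight S \<alpha>)) b = coeff ?a \<alpha>"
    using a fundamental_weight_pairing[OF assms(1), of ?a]
    by (simp add: coroot_pairing_word_prod_left pos_roots_def)
  have "coeff ?a \<alpha> \<noteq> 0"
  proof
    assume 0: "coeff ?a \<alpha> = 0"
    have lin: "linear w" by (simp only: w linear_word_prod)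
    \<comment> \<open>The suffix \<open>ds\<close> cancels, and the letter \<open>b\<close> negates
      its own root.\<close>
    have "w ?a = - word_prod cs b"
      using root_nonzero[OF bR] by (simp add: w root_reflection_self linear_neg[OF linear_word_prod])
    moreover have "0 \<le> coeff (w ?a) c" for c
    proof -
      have "w ?a = w (\<Sum>d\<in>S. coeff ?a d *\<^sub>R d)" by (simp only: sum_coeff)
      also have "\<dots> = (\<Sum>d\<in>S. coeff ?a d *\<^sub>R w d)"
        by (simp add: linear_sum[OF lin] linear_scale[OF lin])
      finally have "coeff (w ?a) c = (\<Sum>d\<in>S. coeff ?a d * coeff (w d) c)"
        by (metis (no_types, lifting) coeff_sum coeff_scale sum.cong)
      moreover have "0 \<le> coeff ?a d * coeff (w d) c" if "d \<in> S" for d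
      proof (cases "d = \<alpha>")
        case False
        then have "w d \<in> pos_roots R S" using assms(3) that by (auto simp: min_coset_reps_def)
        then show ?thesis using pos_root_coeff a by simp
      qed (simp add: 0)
      ultimately show ?thesis by (simp add: sum_nonneg)
    qed
    ultimately have "coeff (word_prod cs b) c = 0" for c
      using pos_root_coeff[OF pos, of c] by (metis coeff_minus neg_0_le_iff_le order_antisym)
    then have "word_prod cs b = 0" using sum_coeff[of "word_prod cs b"] by simp
    then show False using pos root_nonzero by (auto simp: pos_roots_def)
  qed
  moreover obtain n :: nat where "coeff ?a \<alpha> = real n"
    using pos_root_coeff_Nats[OF a assms(1)] by blast
  moreover have "coeff ?a \<alpha> \<le> 1"
    using minuscule_pairing_le_1[OF assms(1,2) sub(3) bR] pair by simp
  ultimately have "coeff ?a \<alpha> = 1" by (cases n) auto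
  moreover have "lowering_word (fundamental_weight S \<alpha>) ds"
    using Cons.IH[of "cs @ [b]"] Cons.prems by simp
  ultimately show ?case using pair by simp
qed simp

text \<open>
  A positive pairing of the root with the next letter would give it pairing at least \<open>2\<close> with the
  next weight, contradicting minusculity.
\<close>

lemma lowering_word_raises_root:
  assumes "\<alpha> \<in> S" "minuscule R S \<alpha>"
    and "lowering_word (fundamental_weight S \<alpha>) cs" "set cs \<subseteq> S" "\<gamma> \<in> R"
    and "coroot_pairing (word_prod cs (fundamental_weight S \<alpha>)) \<gamma> = 1"
  shows "weight_le S \<gamma> (word_prod (rev cs) \<gamma>) \<and>
    (word_prod (rev cs) \<gamma> = \<gamma> \<longrightarrow> (\<forall>b\<in>set cs. \<gamma> \<bullet> b = 0))"
  using assms(3-)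
proof (induction cs arbitrary: \<gamma>)
  case Nil
  then show ?case by (simp add: weight_le_refl)
next
  case (Cons b cs)
  let ?u = "word_prod cs (fundamental_weight S \<alpha>)"
  let ?\<gamma> = "root_reflection b \<gamma>"
  have bR: "b \<in> R" and bS: "b \<in> S" using Cons.prems base_subset by auto
  have refl: "root_reflection b ?u = ?u - b"
    using Cons.prems by (simp add: root_reflection_def)
  have "coroot_pairing ?u \<gamma> = 1 + coroot_pairing b \<gamma>"
    using Cons.prems(4) by (simp add: refl coroot_pairing_diff_left)
  moreover have "coroot_pairing ?u \<gamma> \<le> 1"
    using minuscule_pairing_le_1[OF assms(1,2), of cs \<gamma>] Cons.prems by simp
  ultimately have le: "coroot_pairing \<gamma> b \<le> 0"
    using root_pairing_commute[OF bR Cons.prems(3)] by simp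
  then obtain n :: nat where n: "coroot_pairing \<gamma> b = - real n"
    using root_pairing_Ints[OF Cons.prems(3) bR]
    by (metis Ints_cases nonpos_int_cases of_int_le_0_iff of_int_minus of_int_of_nat_eq)
  then have step: "weight_le S \<gamma> ?\<gamma>"
    using weight_le_add_multiple[OF finite_base bS, of \<gamma> n] by (simp add: root_reflection_def)
  have "coroot_pairing ?u ?\<gamma> = 1"
    using Cons.prems(4) coroot_pairing_word_prod_left[of "[b]" ?u \<gamma>] by simp
  then have IH: "weight_le S ?\<gamma> (word_prod (rev cs) ?\<gamma>)"
    "word_prod (rev cs) ?\<gamma> = ?\<gamma> \<Longrightarrow> \<forall>b\<in>set cs. ?\<gamma> \<bullet> b = 0"
    using Cons.IH[of ?\<gamma>] Cons.prems reflection_in_roots[OF bR] by auto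
  \<comment> \<open>\<open>\<gamma>\<close> is below \<open>?\<gamma>\<close>, which is below its
    image. If the ends agree, antisymmetry collapses the chain, so the reflection in
    \<open>b\<close> already fixes \<open>\<gamma>\<close>.\<close>
  have "\<forall>c\<in>set (b # cs). \<gamma> \<bullet> c = 0" if eq: "word_prod (rev cs) ?\<gamma> = \<gamma>"
  proof -
    have fixed: "?\<gamma> = \<gamma>" using weight_le_antisym step IH(1) eq by metis
    then have "\<gamma> \<bullet> b = 0"
      using root_nonzero[OF bR] by (simp add: root_reflection_def coroot_pairing_eq_0_iff)
    then show ?thesis using IH(2) fixed eq by auto
  qed
  then show ?case using weight_le_trans[OF step IH(1)] by simp
qed

section \<open>Vanishing coefficients and the sink of the quiver\<close>

lemma coeff_word_prod:
  assumes "set bs \<subseteq> S" "c \<notin> set bs"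
  shows "coeff (word_prod bs x) c = coeff x c"
  using assms
  by (induction bs) (auto simp: root_reflection_def coeff_diff coeff_scale coeff_base)

text \<open>The term at \<open>a\<close> is 0 and distinct simple roots have non-positive products,
  so all terms of \<open>\<gamma> \<bullet> a\<close> have the same sign; their sum being 0, each
  vanishes.\<close>

lemma orthogonal_coeff_0:
  assumes "\<And>b. 0 \<le> coeff \<gamma> b" "a \<in> S" "coeff \<gamma> a = 0" "\<gamma> \<bullet> a = 0" "b \<in> S" "b \<bullet> a \<noteq> 0"
  shows "coeff \<gamma> b = 0"
proof -
  have "0 = (\<Sum>c\<in>S. coeff \<gamma> c *\<^sub>R c) \<bullet> a" using assms by (simp only: sum_coeff)
  then have "(\<Sum>c\<in>S. - (coeff \<gamma> c * (c \<bullet> a))) = 0"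
    by (simp add: inner_sum_left sum_negf)
  moreover have "0 \<le> - (coeff \<gamma> c * (c \<bullet> a))" if "c \<in> S" for c
    using assms base_inner_nonpos[OF that assms(2)]
    by (cases "c = a") (auto intro: mult_nonneg_nonpos)
  ultimately have "- (coeff \<gamma> b * (b \<bullet> a)) = 0"
    using sum_nonneg_eq_0_iff[OF finite_base, of "\<lambda>c. - (coeff \<gamma> c * (c \<bullet> a))"] assms(5) by simp
  then show ?thesis using assms by simp
qed

text \<open>A letter orthogonal to all later ones has pairing 1 with the fundamental weight itself,
  hence is \<open>\<alpha>\<close>. The last letter is of this kind; any earlier one would be
  \<open>\<alpha>\<close> too, and so not orthogonal to the last.\<close>

lemma quiver_unique_sink:
  assumes "\<alpha> \<in> S" "lowering_word (fundamental_weight S \<alpha>) bs" "set bs \<subseteq> S" "k < length bs"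
  shows "bs ! (length bs - 1) = \<alpha>" "quiver_le bs (length bs - 1) k"
proof -
  let ?x = "fundamental_weight S \<alpha>" and ?r = "length bs - 1"
  have sink: "bs ! k = \<alpha>" if k: "k < length bs" "\<And>q. k < q \<Longrightarrow> q < length bs \<Longrightarrow> (bs ! k) \<bullet> (bs ! q) = 0" for k
  proof -
    have "coroot_pairing (word_prod (drop (Suc k) bs) ?x) (bs ! k)
       = coroot_pairing (word_prod (drop (length bs) bs) ?x) (bs ! k)"
      by (rule coroot_pairing_drop_orthogonal) (use k in auto)
    then have "coroot_pairing ?x (bs ! k) = 1"
      using lowering_word_nth[OF assms(2) k(1)] by simp
    then show ?thesis
      using fundamental_weight_pairing_base[OF assms(1), of "bs ! k"] assms(3) nth_mem[OF k(1)]
      by (auto split: if_splits)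
  qed
  show last: "bs ! ?r = \<alpha>" by (rule sink) (use assms(4) in auto)
  have S_nonzero: "0 \<notin> S" using base_subset root_nonzero by auto
  then have nz: "0 \<notin> set bs" using assms(3) by auto
  show "quiver_le bs ?r k" using assms(4)
  proof (induction "length bs - k" arbitrary: k rule: less_induct)
    case less
    show ?case
    proof (cases "\<exists>q. k < q \<and> q < length bs \<and> (bs ! k) \<bullet> (bs ! q) \<noteq> 0")
      case True
      then obtain q where q: "k < q" "q < length bs" "(bs ! k) \<bullet> (bs ! q) \<noteq> 0" by blast
      then have "quiver_le bs q k" by (rule quiver_le_of_nonorthogonal[OF assms(2) nz])
      moreover have "quiver_le bs ?r q" using less.hyps[of q] q less.prems by auto
      ultimately show ?thesis by (blast intro: quiver_le_trans)
    next
      case False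
      then have "bs ! k = \<alpha>" using sink less.prems by blast
      then have "k = ?r"
        using False last assms(1) S_nonzero less.prems
        by (metis Suc_diff_1 inner_eq_zero_iff less_Suc_eq length_pos_if_in_set nth_mem diff_Suc_less)
      then show ?thesis by (simp add: quiver_le_refl)
    qed
  qed
qed

end

section \<open>Comparison of the two images of the first root\<close>

theorem proposition5p7:
  fixes R S :: "'a::euclidean_space set" and \<alpha> :: 'a
    and w :: "'a \<Rightarrow> 'a" and ws :: "('a \<Rightarrow> 'a) list" and \<beta>s :: "'a list"
  assumes "root_system R" and "irreducible_roots R" and "simply_laced R"
    and "root_base R S"
    and "\<alpha> \<in> S" and "minuscule R S \<alpha>"
    and "w \<in> min_coset_reps R S (S - {\<alpha>})" and "w \<noteq> id"
    and "perrin_decomposition S w ws"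
    and "reduced_decomposition S w \<beta>s" and "refining_decomposition S \<beta>s ws"
    and "w \<noteq> ws ! 0"
  shows "weight_less S (inv w (\<beta>s ! 0)) (inv (ws ! 0) (\<beta>s ! 0))"
proof -
  interpret simply_laced_base R S by standard (use assms in auto)
  let ?x = "fundamental_weight S \<alpha>"
  obtain bs ps where bs: "reduced_decomposition S w bs" and ps: "distinct ps" "set ps = peaks bs"
    and ws: "ws = map (peak_factor bs ps) [0..<length ps]"
    using assms(9) unfolding perrin_decomposition_def by blast
  have bsS: "set bs \<subseteq> S" and wbs: "w = word_prod bs"
    using bs by (auto simp: reduced_decomposition_def)
  have nz: "0 \<notin> set bs" using bsS base_subset root_nonzero by auto
  have low: "lowering_word ?x cs" if "reduced_decomposition S w cs" for cs
    using reduced_coset_rep_lowering[OF assms(5-7), of "[]" cs] that by simp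
  have bs_ne: "bs \<noteq> []" using assms(8) wbs by auto
  then have "ps \<noteq> []" using exists_peak_above[of 0 bs] ps by auto
  define U where "U k \<longleftrightarrow> last_peak_above bs ps k = 0" for k
  have U_iff: "U k \<longleftrightarrow> (\<forall>t<length ps. quiver_le bs k (ps ! t) \<longrightarrow> t = 0)" if "k < length bs" for k
    using last_peak_above_eq_0_iff[OF ps(2) that] by (simp add: U_def)
  \<comment> \<open>The first factor is closed upwards: a peak above \<open>i\<close> is also above
    \<open>j\<close>.\<close>
  have U_up: "U i" if "U j" "quiver_le bs j i" "j < length bs" for i j
    using that U_iff quiver_le_trans quiver_le_imp_le by (meson le_less_trans)
  define F where "F = map ((!) bs) (filter U [0..<length bs])"
  define G where "G = map ((!) bs) (filter (\<lambda>k. \<not> U k) [0..<length bs])"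
  have w1: "ws ! 0 = word_prod F"
    using \<open>ps \<noteq> []\<close> by (simp add: ws peak_factor_def F_def U_def[abs_def])
  \<comment> \<open>If such a pair were not orthogonal, the later vertex would lie below the earlier
    one, and \<open>U_up\<close> would put the earlier one into \<open>U\<close>.\<close>
  have "sorted_wrt (\<lambda>i j. \<not> U i \<longrightarrow> U j \<longrightarrow> bs ! i \<bullet> bs ! j = 0) [0..<length bs]"
    unfolding sorted_wrt_iff_nth_less
    using quiver_le_of_nonorthogonal[OF low[OF bs] nz] U_up by auto
  from word_prod_filter[OF this] have w_split: "w = word_prod F \<circ> word_prod G"
    by (simp add: wbs F_def G_def map_nth)
  have FS: "set F \<subseteq> S" and GS: "set G \<subseteq> S" using bsS by (auto simp: F_def G_def)
  \<comment> \<open>\<open>F @ G\<close> rearranges the letters of \<open>bs\<close>, so it is again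
    reduced, and its suffix \<open>G\<close> inherits the lowering property.\<close>
  have "length F + length G = length bs"
    using sum_length_filter_compl[of U "[0..<length bs]"] by (simp add: F_def G_def)
  then have "reduced_decomposition S w (F @ G)"
    using bs FS GS w_split by (auto simp: reduced_decomposition_def)
  then have lowG: "lowering_word ?x G" using low lowering_word_append by blast

  obtain b cs where \<beta>s: "\<beta>s = b # cs"
    using assms(8,10) by (cases \<beta>s) (auto simp: reduced_decomposition_def)
  have b: "b \<in> S" "w = word_prod (b # cs)"
    using assms(10) by (auto simp: reduced_decomposition_def \<beta>s)
  \<comment> \<open>The rest of the word gives pairing 1 with \<open>b\<close>, and the reflection
    in \<open>b\<close> changes the sign.\<close>
  have wb: "coroot_pairing (w ?x) b = -1"
    using low[OF assms(10)] by (simp add: b(2) \<beta>s coroot_pairing_root_reflection_self)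
  define \<gamma> where "\<gamma> = - word_prod (rev F) b"
  have \<gamma>R: "\<gamma> \<in> R"
    unfolding \<gamma>_def using FS b base_subset by (intro uminus_in_roots word_prod_in_roots) auto
  have pair\<gamma>: "coroot_pairing (word_prod G ?x) \<gamma> = 1"
    using wb coroot_pairing_word_prod_left[of F "word_prod G ?x" b]
    by (simp add: \<gamma>_def coroot_pairing_minus_right w_split)
  note raise = lowering_word_raises_root[OF assms(5,6) lowG GS \<gamma>R pair\<gamma>]
  have inv1: "inv (ws ! 0) b = - \<gamma>" by (simp add: w1 inv_word_prod \<gamma>_def)
  have "inv w = word_prod (rev (F @ G))"
    using inv_word_prod[of "F @ G"] w_split by simp
  then have inv2: "inv w b = - word_prod (rev G) \<gamma>"
    by (simp add: \<gamma>_def linear_neg[OF linear_word_prod])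

  have "word_prod (rev G) \<gamma> \<noteq> \<gamma>"
  proof
    assume fixed: "word_prod (rev G) \<gamma> = \<gamma>"
    have orth: "\<gamma> \<bullet> bs ! k = 0" if "k < length bs" "\<not> U k" for k
      using raise fixed that by (auto simp: G_def)
    \<comment> \<open>Moving \<open>G\<close> across the pairing applies its inverse to
      \<open>\<gamma>\<close>, which is fixed.\<close>
    have "coroot_pairing ?x \<gamma> = 1"
      using pair\<gamma> fixed by (simp add: coroot_pairing_word_prod_left)
    then have \<alpha>1: "coeff \<gamma> \<alpha> = 1" using fundamental_weight_pairing[OF assms(5) \<gamma>R] by simp
    then have pos: "0 \<le> coeff \<gamma> c" for c
      using pos_root_of_coeff[OF \<gamma>R, of \<alpha>] pos_root_coeff by simp
    \<comment> \<open>Here \<open>w \<noteq> ws ! 0\<close> enters: a vertex outside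
      \<open>U\<close> lies below a peak of nonzero index.\<close>
    have "\<not> (\<forall>k<length bs. U k)"
    proof
      assume "\<forall>k<length bs. U k"
      then have "filter U [0..<length bs] = [0..<length bs]" by (auto simp: filter_id_conv)
      then show False using assms(12) w1 by (simp add: F_def wbs map_nth)
    qed
    then obtain t where t: "t < length ps" "t \<noteq> 0" using U_iff by blast
    define p where "p = ps ! t"
    have p: "p \<in> peaks bs" using nth_mem[OF t(1)] ps(2) by (simp add: p_def)
    then have p_len: "p < length bs" by (simp add: peaks_def)
    have below: "\<not> U k" if "quiver_le bs k p" "k < length bs" for k
      using that U_iff t p_def by blast
    \<comment> \<open>Positions with equal letters are comparable: one before \<open>p\<close> would
      lie above a peak, one after \<open>p\<close> lies below it and so outside
      \<open>U\<close>.\<close>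
    have "bs ! p \<notin> set F"
    proof
      assume "bs ! p \<in> set F"
      then obtain k where k: "k < length bs" "U k" "bs ! k = bs ! p" by (auto simp: F_def)
      have nzp: "bs ! p \<bullet> bs ! p \<noteq> 0" using nz p_len by (metis inner_eq_zero_iff nth_mem)
      have "k \<noteq> p" using below[of p] quiver_le_refl k by auto
      then consider "k < p" | "p < k" by linarith
      then show False
      proof cases
        case 1
        then have "quiver_le bs p k"
          using quiver_le_of_nonorthogonal[OF low[OF bs] nz] p_len k nzp by simp
        then show False using p 1 k(1) unfolding peaks_def by blast
      next
        case 2
        then have "quiver_le bs k p"
          using quiver_le_of_nonorthogonal[OF low[OF bs] nz] k nzp by simp
        then show False using below k by blast
      qed
    qed
    then have "coeff \<gamma> (bs ! p) = - coeff b (bs ! p)"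
      using coeff_word_prod[of "rev F"] FS by (simp add: \<gamma>_def coeff_minus)
    \<comment> \<open>The coefficient is non-negative, yet it is minus that of a simple root, so 0
      or -1.\<close>
    then have start: "coeff \<gamma> (bs ! p) = 0"
      using pos[of "bs ! p"] b(1) by (auto simp: coeff_base split: if_splits)
    have path: "(quiver_arrow bs)\<^sup>*\<^sup>* p (length bs - 1)" and last: "bs ! (length bs - 1) = \<alpha>"
      using quiver_unique_sink[OF assms(5) low[OF bs] bsS p_len] by (auto simp: quiver_le_def)
    \<comment> \<open>Every vertex on the path is below \<open>p\<close>, hence outside
      \<open>U\<close>; \<open>\<gamma>\<close> is orthogonal to its letter, so the zero passes to
      the next letter.\<close>
    from path have "coeff \<gamma> (bs ! (length bs - 1)) = 0"
    proof (induction rule: rtranclp_induct)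
      case (step i j)
      then have ij: "i < length bs" "j < length bs" "bs ! j \<bullet> bs ! i \<noteq> 0"
        by (auto simp: quiver_arrow_def coroot_pairing_eq_0_iff inner_commute)
      moreover have "\<not> U i" using below[of i] step ij by (simp add: quiver_le_def)
      ultimately show ?case
        using orthogonal_coeff_0[OF pos, of "bs ! i" "bs ! j"] orth[of i] step.IH
          subsetD[OF bsS nth_mem, of i] subsetD[OF bsS nth_mem, of j] by simp
    qed (rule start)
    then show False using last \<alpha>1 by simp
  qed
  moreover have "weight_le S (- word_prod (rev G) \<gamma>) (- \<gamma>)"
    using raise by (simp add: weight_le_def)
  ultimately show ?thesis by (simp add: weight_less_def \<beta>s inv1 inv2)
qed

end
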